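(* Let $n\geq 1$ and $q\geq 4$ be integers. Then for every $i\in\{1,\ldots,n\}$ there exists a $qi$-eigenfunction $f$ of the Hamming graph $H(n,q)$ such that $\mathrm{SND}(f)=2$.
   Context: The Hamming graph $H(n,q)$ has vertex set $\mathbb{Z}_q^n$, two vertices being adjacent iff they differ in exactly one coordinate. For a graph $G$ with vertex set $V$ and a real number $\lambda$, a $\lambda$-eigenfunction of $G$ is a function $f:V\to\mathbb{R}$ with $f\not\equiv 0$ such that $\lambda f(x)=\sum_{y\in N(x)}(f(x)-f(y))$ for every $x\in V$, where $N(x)$ is the set of neighbours of $x$. A positive (negative) strong nodal domain of $f$ is a maximal connected induced subgraph of $G$ on vertices $x$ with $f(x)>0$ ($f(x)<0$); $\mathrm{SND}(f)$ denotes the total number of strong nodal domains of $f$. *)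

theory Defs
  imports Complex_Main "HOL-Library.FuncSet" "Graph_Theory.Digraph_Component"
begin

text \<open>
  Undirected simple graphs are rendered as finite symmetric loop-free digraphs without parallel arcs
  (locale \<^locale>\<open>pair_graph\<close>). A vertex of $H(n,q)$ is a function on the index set
  $\{0,\dots,n-1\}$ (\<^const>\<open>undefined\<close> elsewhere), its coordinates being the representatives
  $0,\dots,q-1$ of the residue classes modulo $q$; only equality of coordinates is ever used.
\<close>

definition hamming_graph :: "nat \<Rightarrow> nat \<Rightarrow> (nat \<Rightarrow> nat) pair_pre_digraph" where
  "hamming_graph n q =
     \<lparr> pverts = {..<n} \<rightarrow>\<^sub>E {..<q},
       parcs = {(x, y). x \<in> {..<n} \<rightarrow>\<^sub>E {..<q} \<and> y \<in> {..<n} \<rightarrow>\<^sub>E {..<q} \<and>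
                        card {k \<in> {..<n}. x k \<noteq> y k} = 1} \<rparr>"

lemma pair_graph_hamming_graph: "pair_graph (hamming_graph n q)"
proof
  show "finite (pverts (hamming_graph n q))"
    by (simp add: hamming_graph_def finite_PiE)
  have sub: "parcs (hamming_graph n q) \<subseteq> pverts (hamming_graph n q) \<times> pverts (hamming_graph n q)"
    unfolding hamming_graph_def by auto
  then show "finite (parcs (hamming_graph n q))"
    by (rule finite_subset) (simp add: hamming_graph_def finite_PiE)
  have "(y, x) \<in> parcs (hamming_graph n q)" if "(x, y) \<in> parcs (hamming_graph n q)" for x y
  proof -
    have "{k \<in> {..<n}. y k \<noteq> x k} = {k \<in> {..<n}. x k \<noteq> y k}" by auto
    with that show ?thesis unfolding hamming_graph_def by simp
  qed
  then show "symmetric (with_proj (hamming_graph n q))"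
    by (simp add: symmetric_def arcs_ends_def arc_to_ends_def sym_def)
  fix e assume e: "e \<in> parcs (hamming_graph n q)"
  show "fst e \<in> pverts (hamming_graph n q)" and "snd e \<in> pverts (hamming_graph n q)"
    using e sub by (metis mem_Times_iff subsetD)+
  show "fst e \<noteq> snd e"
  proof
    assume "fst e = snd e"
    then have "card {k \<in> {..<n}. fst e k \<noteq> snd e k} = 0" by simp
    moreover from e have "card {k \<in> {..<n}. fst e k \<noteq> snd e k} = 1"
      unfolding hamming_graph_def by (simp add: case_prod_unfold)
    ultimately show False by (metis zero_neq_one)
  qed
qed

definition neighbours :: "('a, 'b) pre_digraph \<Rightarrow> 'a \<Rightarrow> 'a set" where
  "neighbours G x = {y \<in> verts G. x \<rightarrow>\<^bsub>G\<^esub> y}"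

text \<open>
  Functions $V \to \mathbb{R}$ are total functions of which only the values on \<^term>\<open>verts G\<close> matter.
\<close>

definition eigenfunction :: "('a, 'b) pre_digraph \<Rightarrow> real \<Rightarrow> ('a \<Rightarrow> real) \<Rightarrow> bool" where
  "eigenfunction G \<mu> f \<longleftrightarrow>
     (\<exists>x \<in> verts G. f x \<noteq> 0) \<and>
     (\<forall>x \<in> verts G. \<mu> * f x = (\<Sum>y \<in> neighbours G x. f x - f y))"

definition positive_strong_nodal_domains ::
    "('a, 'b) pre_digraph \<Rightarrow> ('a \<Rightarrow> real) \<Rightarrow> ('a, 'b) pre_digraph set" where
  "positive_strong_nodal_domains G f =
     {H. pre_digraph.max_subgraph G
           (\<lambda>K. induced_subgraph K G \<and> connected K \<and> (\<forall>x \<in> verts K. f x > 0)) H}"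

definition negative_strong_nodal_domains ::
    "('a, 'b) pre_digraph \<Rightarrow> ('a \<Rightarrow> real) \<Rightarrow> ('a, 'b) pre_digraph set" where
  "negative_strong_nodal_domains G f =
     {H. pre_digraph.max_subgraph G
           (\<lambda>K. induced_subgraph K G \<and> connected K \<and> (\<forall>x \<in> verts K. f x < 0)) H}"

definition SND :: "('a, 'b) pre_digraph \<Rightarrow> ('a \<Rightarrow> real) \<Rightarrow> nat" where
  "SND G f = card (positive_strong_nodal_domains G f) + card (negative_strong_nodal_domains G f)"

end

theory Submission
  imports Defs
begin

text \<open>
  Write \<open>S x\<close> for the sum of the first \<open>i\<close> coordinates of \<open>x\<close> and let \<open>f x = g (S x mod q)\<close>, where
  \<open>g\<close> is \<open>1\<close> on the residues \<open>0, 1\<close>, is \<open>-1\<close> on \<open>2, 3\<close>, and vanishes elsewhere. Along a line in one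
  of the first \<open>i\<close> directions \<open>S\<close> takes every residue exactly once, so \<open>f\<close> sums to zero there, while
  \<open>f\<close> is constant along the other lines; hence \<open>f\<close> has eigenvalue \<open>q i\<close>. The positive and the negative
  set both have the form \<open>S x mod q \<in> {c, c + 1}\<close> with \<open>c + 1 < q\<close>. Such a set is connected: any unit
  of a coordinate can be transferred to coordinate \<open>0\<close> without leaving it, one raising and one lowering
  of \<open>S\<close> alternating.
\<close>

section \<open>Strong nodal domains\<close>

text \<open>Every admissible subgraph lies inside the subgraph induced on the whole set where
  \<open>P\<close> holds. Once that one is connected it is itself admissible, hence the greatest
  admissible subgraph and the only maximal one.\<close>

lemma max_subgraph_induced_connected:
  assumes wf: "wf_digraph G" and con: "connected (G \<restriction> {x \<in> verts G. P x})"
  shows "{H. pre_digraph.max_subgraph G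
            (\<lambda>K. induced_subgraph K G \<and> connected K \<and> (\<forall>x \<in> verts K. P x)) H}
         = {G \<restriction> {x \<in> verts G. P x}}"
    (is "{H. pre_digraph.max_subgraph G ?Q H} = {?M}")
proof -
  interpret wf_digraph G by fact
  have ind: "induced_subgraph ?M G" by (rule induced_induce) auto
  have sub: "subgraph K ?M" if "?Q K" for K
  proof -
    have "subgraph K G" using that by (simp add: induced_imp_subgraph)
    moreover from this have "verts K \<subseteq> {x \<in> verts G. P x}"
      using that subgraph_imp_subverts by blast
    moreover have "wf_digraph ?M" by (rule wellformed_induce_subgraph)
    ultimately show ?thesis
      by (auto simp: subgraph_def compatible_def dest: wf_digraph.wellformed)
  qed
  have Q: "?Q ?M" using ind con by simp
  have "max_subgraph ?Q ?M"
  proof (rule max_subgraphI)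
    fix K assume K: "?M \<noteq> K" "subgraph ?M K" "subgraph K G"
    show "\<not> ?Q K"
    proof
      assume QK: "?Q K"
      \<comment> \<open>Inclusions in both directions; an induced subgraph is determined by its
        vertex set.\<close>
      have "verts K = verts ?M"
        using K(2) sub[OF QK] by (metis subgraph_imp_subverts subset_antisym)
      then show False using QK K(1) ind induce_eq_iff_induced by metis
    qed
  qed (use Q ind in \<open>auto simp: induced_imp_subgraph\<close>)
  moreover have "H = ?M" if "max_subgraph ?Q H" for H
    using max_subgraph_subg_eq[OF that calculation sub] that by (simp add: max_subgraph_def)
  ultimately show ?thesis by blast
qed

lemma SND_eq_2:
  assumes "wf_digraph G"
    and "connected (G \<restriction> {x \<in> verts G. f x > 0})"
    and "connected (G \<restriction> {x \<in> verts G. f x < 0})"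
  shows "SND G f = 2"
  using max_subgraph_induced_connected[OF assms(1,2)] max_subgraph_induced_connected[OF assms(1,3)]
  unfolding SND_def positive_strong_nodal_domains_def negative_strong_nodal_domains_def by simp

section \<open>Neighbours in the Hamming graph\<close>

lemma hamming_update_arc:
  assumes "x \<in> {..<n} \<rightarrow>\<^sub>E {..<q}" "k < n" "v < q" "v \<noteq> x k"
  shows "(x, x(k := v)) \<in> parcs (hamming_graph n q)"
proof -
  have "{l \<in> {..<n}. x l \<noteq> (x(k := v)) l} = {k}" using assms by auto
  moreover have "x(k := v) \<in> {..<n} \<rightarrow>\<^sub>E {..<q}" using assms by (auto simp: PiE_iff extensional_def)
  ultimately show ?thesis using assms by (simp add: hamming_graph_def)
qed

lemma neighbours_hamming_graph:
  assumes x: "x \<in> {..<n} \<rightarrow>\<^sub>E {..<q}"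
  shows "neighbours (with_proj (hamming_graph n q)) x
    = (\<lambda>(k, v). x(k := v)) ` (SIGMA k:{..<n}. {..<q} - {x k})"
proof (intro equalityI subsetI)
  fix y assume "y \<in> neighbours (with_proj (hamming_graph n q)) x"
  then have y: "y \<in> {..<n} \<rightarrow>\<^sub>E {..<q}" and "card {k \<in> {..<n}. x k \<noteq> y k} = 1"
    by (auto simp: neighbours_def hamming_graph_def)
  then obtain k where k: "{k \<in> {..<n}. x k \<noteq> y k} = {k}" by (auto simp: card_1_singleton_iff)
  then have "k < n" "x k \<noteq> y k" by auto
  moreover have "y = x(k := y k)"
  proof
    fix l show "y l = (x(k := y k)) l"
      using k x y by (cases "l < n") (auto simp: PiE_iff extensional_def)
  qed
  moreover have "y k < q" using y \<open>k < n\<close> by auto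
  ultimately show "y \<in> (\<lambda>(k, v). x(k := v)) ` (SIGMA k:{..<n}. {..<q} - {x k})"
    by (intro image_eqI[of _ _ "(k, y k)"]) auto
next
  fix y assume "y \<in> (\<lambda>(k, v). x(k := v)) ` (SIGMA k:{..<n}. {..<q} - {x k})"
  then obtain k v where kv: "k < n" "v < q" "v \<noteq> x k" "y = x(k := v)" by auto
  then have "(x, y) \<in> parcs (hamming_graph n q)" using hamming_update_arc[OF x] by blast
  then show "y \<in> neighbours (with_proj (hamming_graph n q)) x"
    by (auto simp: neighbours_def hamming_graph_def)
qed

text \<open>The inner sum runs over a whole line through \<open>x\<close>: the added term
  \<open>v = x k\<close> is zero. Cancellation along complete lines can then be applied
  directly.\<close>

lemma sum_neighbours_hamming_graph:
  fixes f :: "(nat \<Rightarrow> nat) \<Rightarrow> real"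
  assumes x: "x \<in> {..<n} \<rightarrow>\<^sub>E {..<q}"
  shows "(\<Sum>y \<in> neighbours (with_proj (hamming_graph n q)) x. f x - f y)
    = (\<Sum>k<n. \<Sum>v<q. f x - f (x(k := v)))"
proof -
  have inj: "inj_on (\<lambda>(k, v). x(k := v)) (SIGMA k:{..<n}. {..<q} - {x k})"
  proof (rule inj_onI)
    fix a b
    assume a: "a \<in> (SIGMA k:{..<n}. {..<q} - {x k})" and b: "b \<in> (SIGMA k:{..<n}. {..<q} - {x k})"
      and eq: "(\<lambda>(k, v). x(k := v)) a = (\<lambda>(k, v). x(k := v)) b"
    obtain k v l w where kv: "a = (k, v)" "b = (l, w)" by (metis surj_pair)
    then have upd: "x(k := v) = x(l := w)" and "v \<noteq> x k" using a eq by auto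
    then have "k = l" by (metis fun_upd_same fun_upd_other)
    then show "a = b" using upd kv by (metis fun_upd_same)
  qed
  have "(\<Sum>y \<in> neighbours (with_proj (hamming_graph n q)) x. f x - f y)
    = (\<Sum>(k, v) \<in> (SIGMA k:{..<n}. {..<q} - {x k}). f x - f (x(k := v)))"
    unfolding neighbours_hamming_graph[OF x]
    by (subst sum.reindex[OF inj]) (simp add: comp_def case_prod_unfold)
  also have "\<dots> = (\<Sum>k<n. \<Sum>v \<in> {..<q} - {x k}. f x - f (x(k := v)))"
    by (subst sum.Sigma) auto
  also have "\<dots> = (\<Sum>k<n. \<Sum>v<q. f x - f (x(k := v)))"
    by (rule sum.cong[OF refl], rule sum.mono_neutral_left) auto
  finally show ?thesis .
qed

section \<open>Functions of a partial coordinate sum\<close>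

lemma sum_fun_upd_lessThan:
  fixes x :: "nat \<Rightarrow> nat"
  assumes "k < i"
  shows "(\<Sum>l<i. (x(k := v)) l) + x k = (\<Sum>l<i. x l) + v"
proof -
  have "(\<Sum>l<i. (x(k := v)) l) = v + (\<Sum>l \<in> {..<i} - {k}. x l)"
    using assms by (subst sum.remove[of _ k]) auto
  moreover have "(\<Sum>l<i. x l) = x k + (\<Sum>l \<in> {..<i} - {k}. x l)"
    using assms by (subst sum.remove[of _ k]) auto
  ultimately show ?thesis by simp
qed

lemma sum_mod_shift:
  fixes g :: "nat \<Rightarrow> real"
  shows "(\<Sum>v<q. g ((r + v) mod q)) = (\<Sum>v<q. g v)"
proof (induction r)
  case (Suc r)
  \<comment> \<open>The \<open>q + 1\<close> consecutive terms begin and end with the same value, as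
    \<open>(r + q) mod q = r mod q\<close>. Dropping the first term gives the sum for
    \<open>Suc r\<close>, dropping the last the sum for \<open>r\<close>.\<close>
  have "(\<Sum>v<q. g ((Suc r + v) mod q)) + g (r mod q) = (\<Sum>v<Suc q. g ((r + v) mod q))"
    by (subst sum.lessThan_Suc_shift) simp
  then show ?case using Suc by simp
qed simp

lemma eigenfunction_hamming_coordinate_sum:
  fixes g :: "nat \<Rightarrow> real"
  assumes i: "i \<le> n" and g: "(\<Sum>v<q. g v) = 0"
    and nz: "\<exists>x \<in> {..<n} \<rightarrow>\<^sub>E {..<q}. g ((\<Sum>k<i. x k) mod q) \<noteq> 0"
  shows "eigenfunction (with_proj (hamming_graph n q)) (real (q * i)) (\<lambda>x. g ((\<Sum>k<i. x k) mod q))"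
proof -
  define f where "f = (\<lambda>x. g ((\<Sum>k<i. x k) mod q))"
  have line: "(\<Sum>v<q. f x - f (x(k := v))) = (if k < i then real q * f x else 0)" for x k
  proof (cases "k < i")
    case True
    define r where "r = (\<Sum>l \<in> {..<i} - {k}. x l)"
    have "(\<Sum>l<i. (x(k := v)) l) = r + v" for v
      using True unfolding r_def by (subst sum.remove[of _ k]) auto
    then have "(\<Sum>v<q. f (x(k := v))) = 0"
      using sum_mod_shift[of g r q] g by (simp add: f_def)
    then show ?thesis using True by (simp add: sum_subtractf)
  next
    case False
    then have "(\<Sum>l<i. (x(k := v)) l) = (\<Sum>l<i. x l)" for v
      by (intro sum.cong) auto
    then show ?thesis using False by (simp add: f_def)
  qed
  have "real (q * i) * f x = (\<Sum>y \<in> neighbours (with_proj (hamming_graph n q)) x. f x - f y)"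
    if "x \<in> {..<n} \<rightarrow>\<^sub>E {..<q}" for x
  proof -
    have "{..<n} \<inter> {k. k < i} = {..<i}" using i by auto
    then show ?thesis
      unfolding sum_neighbours_hamming_graph[OF that] line by (simp add: sum.If_cases)
  qed
  then show ?thesis
    using nz unfolding eigenfunction_def f_def by (simp add: hamming_graph_def)
qed

section \<open>Connectedness of two consecutive levels\<close>

text \<open>The bound on \<open>c\<close> keeps the two residues from wrapping around. The positive
  set is the instance \<open>c = 0\<close>, the negative set the instance
  \<open>c = 2\<close>.\<close>

locale consecutive_levels =
  fixes n q i c :: nat
  assumes i: "1 \<le> i" "i \<le> n" and c: "Suc c < q"
begin

definition levels :: "(nat \<Rightarrow> nat) set" where
  "levels = {x \<in> {..<n} \<rightarrow>\<^sub>E {..<q}. (\<Sum>k<i. x k) mod q \<in> {c, Suc c}}"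

lemma levels_coordinate_less: "x \<in> levels \<Longrightarrow> k < n \<Longrightarrow> x k < q"
  unfolding levels_def by (blast dest: PiE_mem)

abbreviation level_graph where
  "level_graph \<equiv> with_proj (hamming_graph n q) \<restriction> levels"

sublocale H: pair_graph "hamming_graph n q"
  by (rule pair_graph_hamming_graph)

sublocale L: wf_digraph level_graph
  by (rule H.wellformed_induce_subgraph)

text \<open>The single move from which all paths are built. Reachability instead of adjacency also
  admits the trivial move \<open>v = x k\<close>.\<close>

lemma level_graph_update:
  assumes x: "x \<in> levels" and kv: "k < n" "v < q"
    and s: "(\<Sum>l<i. (x(k := v)) l) mod q \<in> {c, Suc c}"
  shows "x(k := v) \<in> levels" and "x \<rightarrow>\<^sup>*\<^bsub>level_graph\<^esub> x(k := v)"
proof -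
  have V: "x \<in> {..<n} \<rightarrow>\<^sub>E {..<q}" using x by (simp add: levels_def)
  then have "x(k := v) \<in> {..<n} \<rightarrow>\<^sub>E {..<q}" using kv by (auto simp: PiE_iff extensional_def)
  then show L: "x(k := v) \<in> levels" using s by (simp add: levels_def)
  show "x \<rightarrow>\<^sup>*\<^bsub>level_graph\<^esub> x(k := v)"
  proof (cases "v = x k")
    case True
    then show ?thesis using x by simp
  next
    case False
    then have "(x, x(k := v)) \<in> arcs level_graph"
      using hamming_update_arc[OF V kv] x L by simp
    then have "x \<rightarrow>\<^bsub>level_graph\<^esub> x(k := v)"
      by (intro L.dominatesI[of "(x, x(k := v))"]) (simp_all add: arc_to_ends_def)
    then show ?thesis by (rule L.reachable_adjI)
  qed
qed

text \<open>A coordinate beyond the first \<open>i\<close> does not enter the sum and can always be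
  lowered; any other one takes the residue from \<open>Suc c\<close> to \<open>c\<close>.\<close>

lemma lower_coordinate:
  assumes x: "x \<in> levels" and k: "k < n" "0 < x k"
    and s: "i \<le> k \<or> (\<Sum>l<i. x l) mod q = Suc c"
  shows "x(k := x k - 1) \<in> levels" and "x \<rightarrow>\<^sup>*\<^bsub>level_graph\<^esub> x(k := x k - 1)"
proof -
  have "x k < q" using levels_coordinate_less[OF x] k by simp
  then have v: "x k - 1 < q" by simp
  have "(\<Sum>l<i. (x(k := x k - 1)) l) mod q \<in> {c, Suc c}"
  proof (cases "i \<le> k")
    case True
    then have "(\<Sum>l<i. (x(k := x k - 1)) l) = (\<Sum>l<i. x l)" by (intro sum.cong) auto
    then show ?thesis using x by (simp add: levels_def)
  next
    case False
    then have "Suc (\<Sum>l<i. (x(k := x k - 1)) l) = (\<Sum>l<i. x l)"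
      using sum_fun_upd_lessThan[of k i x "x k - 1"] k by simp
    \<comment> \<open>In \<open>mod_Suc\<close> the wrapping case would give residue
      \<open>0\<close>, which is not \<open>Suc c\<close>.\<close>
    then show ?thesis using s False mod_Suc[of "\<Sum>l<i. (x(k := x k - 1)) l" q] c
      by (auto split: if_splits)
  qed
  then show "x(k := x k - 1) \<in> levels" "x \<rightarrow>\<^sup>*\<^bsub>level_graph\<^esub> x(k := x k - 1)"
    using level_graph_update[OF x k(1) v] by auto
qed

text \<open>Coordinate \<open>0\<close> is raised cyclically: passing from \<open>q - 1\<close> to
  \<open>0\<close> changes the sum by \<open>1 - q\<close>, which is still \<open>1\<close> modulo
  \<open>q\<close>. So this move is never blocked.\<close>

lemma raise_coordinate_0:
  assumes x: "x \<in> levels" and s: "(\<Sum>l<i. x l) mod q = c"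
  defines "y \<equiv> x(0 := Suc (x 0) mod q)"
  shows "y \<in> levels" and "x \<rightarrow>\<^sup>*\<^bsub>level_graph\<^esub> y" and "(\<Sum>l<i. y l) mod q = Suc c"
proof -
  have x0: "x 0 < q" using levels_coordinate_less[OF x] i by simp
  have e: "(\<Sum>l<i. y l) + x 0 = (\<Sum>l<i. x l) + Suc (x 0) mod q"
    unfolding y_def using sum_fun_upd_lessThan[of 0 i x] i by simp
  have "(\<Sum>l<i. y l) mod q = Suc (\<Sum>l<i. x l) mod q"
  proof (cases "Suc (x 0) = q")
    case True
    then have "(\<Sum>l<i. y l) + q = Suc (\<Sum>l<i. x l)" using e by simp
    then show ?thesis by (metis mod_add_self2)
  next
    case False
    then show ?thesis using e x0 by simp
  qed
  then show s': "(\<Sum>l<i. y l) mod q = Suc c" using s c by (simp add: mod_Suc)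
  then have "(\<Sum>l<i. y l) mod q \<in> {c, Suc c}" by simp
  then show "y \<in> levels" "x \<rightarrow>\<^sup>*\<^bsub>level_graph\<^esub> y"
    using level_graph_update[OF x, of 0 "Suc (x 0) mod q"] i x0 unfolding y_def by simp_all
qed

text \<open>Induction on the sum of all coordinates except coordinate \<open>0\<close>, so that
  raising coordinate \<open>0\<close> costs nothing.\<close>

lemma reaches_axis:
  assumes "x \<in> levels"
  shows "\<exists>z \<in> levels. (\<forall>k \<in> {0<..<n}. z k = 0) \<and> x \<rightarrow>\<^sup>*\<^bsub>level_graph\<^esub> z"
  using assms
proof (induction "\<Sum>k \<in> {0<..<n}. x k" arbitrary: x rule: less_induct)
  case less
  show ?case
  proof (cases "\<forall>k \<in> {0<..<n}. x k = 0")
    case True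
    then show ?thesis using less.prems by (intro bexI[of _ x]) auto
  next
    case False
    then obtain k where k: "0 < k" "k < n" "0 < x k" by auto
    have "\<exists>y \<in> levels. x \<rightarrow>\<^sup>*\<^bsub>level_graph\<^esub> y \<and> (\<Sum>l \<in> {0<..<n}. y l) < (\<Sum>l \<in> {0<..<n}. x l)"
    proof (cases "i \<le> k \<or> (\<Sum>l<i. x l) mod q = Suc c")
      case True
      have "(\<Sum>l \<in> {0<..<n}. (x(k := x k - 1)) l) < (\<Sum>l \<in> {0<..<n}. x l)"
        using k by (intro sum_strict_mono_ex1) auto
      then show ?thesis using lower_coordinate[OF less.prems k(2,3) True] by blast
    next
      case False
      define w where "w = x(0 := Suc (x 0) mod q)"
      have "(\<Sum>l<i. x l) mod q = c" using False less.prems by (auto simp: levels_def)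
      note w = raise_coordinate_0[OF less.prems this, folded w_def]
      \<comment> \<open>Since \<open>k\<close> is not \<open>0\<close>, raising coordinate
        \<open>0\<close> leaves coordinate \<open>k\<close> alone, and the residue is now
        \<open>Suc c\<close>, as lowering requires.\<close>
      have wk: "0 < w k" using k by (simp add: w_def)
      note y = lower_coordinate[OF w(1) k(2) wk disjI2[OF w(3)]]
      have "(\<Sum>l \<in> {0<..<n}. (w(k := w k - 1)) l) < (\<Sum>l \<in> {0<..<n}. x l)"
        using k by (intro sum_strict_mono_ex1) (auto simp: w_def)
      then show ?thesis using y(1) L.reachable_trans[OF w(2) y(2)] by blast
    qed
    then show ?thesis using less.hyps L.reachable_trans by blast
  qed
qed

lemma connected_level_graph: "connected level_graph"
proof -
  have "symmetric (with_proj (hamming_graph n q))" by (rule H.sym_arcs)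
  then have sym: "symmetric level_graph"
    by (rule induced_graph_imp_symmetric[OF _ H.induced_induce])
       (auto simp: levels_def hamming_graph_def)
  have reach: "u \<rightarrow>\<^sup>*\<^bsub>level_graph\<^esub> v" if uv: "u \<in> levels" "v \<in> levels" for u v
  proof -
    obtain y where y: "y \<in> levels" "\<forall>k \<in> {0<..<n}. y k = 0" "u \<rightarrow>\<^sup>*\<^bsub>level_graph\<^esub> y"
      using reaches_axis uv by blast
    obtain z where z: "z \<in> levels" "\<forall>k \<in> {0<..<n}. z k = 0" "v \<rightarrow>\<^sup>*\<^bsub>level_graph\<^esub> z"
      using reaches_axis uv by blast
    \<comment> \<open>Two points of the axis differ at most in coordinate \<open>0\<close>, so one
      move joins them.\<close>
    have "z = y(0 := z 0)"
    proof
      fix l show "z l = (y(0 := z 0)) l"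
        using y z by (cases "l < n") (auto simp: levels_def PiE_iff extensional_def)
    qed
    moreover have "z 0 < q" using levels_coordinate_less[OF z(1)] i by simp
    moreover have "(\<Sum>l<i. z l) mod q \<in> {c, Suc c}" using z(1) by (simp add: levels_def)
    ultimately have "y \<rightarrow>\<^sup>*\<^bsub>level_graph\<^esub> z"
      using level_graph_update(2)[OF y(1), of 0 "z 0"] i by simp
    then show ?thesis
      using y(3) symmetric_reachable[OF sym z(3)] L.reachable_trans by blast
  qed
  \<comment> \<open>Strong connectedness includes having a vertex; this one has partial sum exactly
    \<open>c\<close>.\<close>
  have "(\<lambda>k\<in>{..<n}. if k = 0 then c else 0) \<in> levels"
  proof -
    have "(\<Sum>k<i. (\<lambda>k\<in>{..<n}. if k = 0 then c else 0) k) = (\<Sum>k<i. if k = 0 then c else 0)"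
      using i by (intro sum.cong) auto
    also have "\<dots> = c" using i by (simp add: sum.delta)
    finally show ?thesis using c by (auto simp: levels_def)
  qed
  then have "strongly_connected level_graph"
    using reach by (intro strongly_connectedI) auto
  then show ?thesis
    unfolding connected_def strongly_connected_def
    using L.reachable_mk_symmetricI by (simp add: mk_symmetric_def)
qed

end

section \<open>The weight function\<close>

definition level_weight :: "nat \<Rightarrow> real" where
  "level_weight r = (if r < 2 then 1 else if r < 4 then - 1 else 0)"

lemma sum_level_weight:
  assumes "4 \<le> q"
  shows "(\<Sum>v<q. level_weight v) = 0"
proof -
  \<comment> \<open>The first four weights cancel and all later ones are zero.\<close>
  have "(\<Sum>v<4 + m. level_weight v) = 0" for m
  proof (induction m)
    case 0
    show ?case by (simp add: level_weight_def lessThan_nat_numeral)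
  next
    case (Suc m)
    moreover have "level_weight (4 + m) = 0" by (simp add: level_weight_def)
    ultimately show ?case by (simp only: add_Suc_right sum.lessThan_Suc)
  qed
  from this[of "q - 4"] show ?thesis using assms by simp
qed

lemma level_weight_pos_iff: "0 < level_weight r \<longleftrightarrow> r \<in> {0, Suc 0}"
  by (auto simp: level_weight_def)

lemma level_weight_neg_iff: "level_weight r < 0 \<longleftrightarrow> r \<in> {2, Suc 2}"
  by (auto simp: level_weight_def)

theorem theorem7:
  fixes n q :: nat
  assumes "n \<ge> 1" and "q \<ge> 4"
  shows "\<forall>i \<in> {1..n}. \<exists>f :: (nat \<Rightarrow> nat) \<Rightarrow> real.
           eigenfunction (with_proj (hamming_graph n q)) (real (q * i)) f \<and>
           SND (with_proj (hamming_graph n q)) f = 2"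
proof
  fix i assume i: "i \<in> {1..n}"
  let ?G = "with_proj (hamming_graph n q)"
  define f :: "(nat \<Rightarrow> nat) \<Rightarrow> real" where "f = (\<lambda>x. level_weight ((\<Sum>k<i. x k) mod q))"
  interpret P: consecutive_levels n q i 0 using i assms by unfold_locales auto
  \<comment> \<open>Here \<open>Suc 2 < q\<close> is exactly the hypothesis
    \<open>q \<ge> 4\<close>.\<close>
  interpret N: consecutive_levels n q i 2 using i assms by unfold_locales auto
  have pos: "{x \<in> verts ?G. f x > 0} = P.levels"
    unfolding P.levels_def f_def level_weight_pos_iff by (simp add: hamming_graph_def)
  have neg: "{x \<in> verts ?G. f x < 0} = N.levels"
    unfolding N.levels_def f_def level_weight_neg_iff by (simp add: hamming_graph_def)
  \<comment> \<open>The zero vector has residue \<open>0\<close> and weight \<open>1\<close>, so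
    \<open>f\<close> is not identically zero.\<close>
  have "(\<lambda>k\<in>{..<n}. 0) \<in> {..<n} \<rightarrow>\<^sub>E {..<q}" using assms by auto
  moreover have "(\<Sum>k<i. (\<lambda>k\<in>{..<n}. 0::nat) k) = 0" using i by (intro sum.neutral) auto
  ultimately have "\<exists>x \<in> {..<n} \<rightarrow>\<^sub>E {..<q}. level_weight ((\<Sum>k<i. x k) mod q) \<noteq> 0"
    by (intro bexI[of _ "\<lambda>k\<in>{..<n}. 0"]) (simp_all add: level_weight_def)
  then have "eigenfunction ?G (real (q * i)) f"
    using eigenfunction_hamming_coordinate_sum[of i n level_weight q] i
      sum_level_weight[OF assms(2)] by (simp add: f_def)
  moreover have "SND ?G f = 2"
    using P.connected_level_graph N.connected_level_graph pos neg
    by (intro SND_eq_2) (simp_all add: P.H.wf_digraph_axioms)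
  ultimately show "\<exists>f. eigenfunction ?G (real (q * i)) f \<and> SND ?G f = 2" by blast
qed

end
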